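(* Let $f:\mathbb{R}^n\to\mathbb{R}$ be continuously differentiable, let $k\ge 0$ be an integer, let $x_0,\dots,x_{k+1}\in\mathbb{R}^n$, and for $0\le i\le k$ put $s_i=x_{i+1}-x_i$ and $y_i=\nabla f(x_{i+1})-\nabla f(x_i)$. Assume $s_i^Ty_i>0$ for $0\le i\le k$. Let $\phi\in[0,1]$, let $B_0=\gamma I\in\mathbb{R}^{n\times n}$ with $\gamma>0$, and let $B_1,\dots,B_{k+1}$ be generated by the Broyden convex class of updates with parameter $\phi$, i.e. for $0\le i\le k$, $$B_{i+1}=B_i-\frac{1}{s_i^TB_is_i}B_is_is_i^TB_i+\frac{1}{y_i^Ts_i}y_iy_i^T+\phi\,(s_i^TB_is_i)\,w_iw_i^T,\qquad w_i=\frac{y_i}{y_i^Ts_i}-\frac{B_is_i}{s_i^TB_is_i}.$$ Let $\Lambda_k\in\mathbb{R}^{(k+1)\times(k+1)}$ be the diagonal matrix $$\Lambda_k=\operatorname{diag}_{0\le i\le k}(\lambda_i),\qquad \lambda_i=\frac{1}{-\dfrac{1-\phi}{s_i^TB_is_i}-\dfrac{\phi}{s_i^Ty_i}}\quad(0\le i\le k).$$ Then $B_{k+1}$ can be written as $$B_{k+1}=B_0+\Psi_kM_k\Psi_k^T,$$ where $\Psi_k=\begin{pmatrix}B_0S_k & Y_k\end{pmatrix}\in\mathbb{R}^{n\times 2(k+1)}$ and $$M_k=\begin{pmatrix}-S_k^TB_0S_k+\phi\Lambda_k & -L_k+\phi\Lambda_k\\ -L_k^T+\phi\Lambda_k & D_k+\phi\Lambda_k\end{pmatrix}^{-1}\in\mathbb{R}^{2(k+1)\times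 2(k+1)}.$$ Here $S_k$, $Y_k$ are the matrices with columns $s_0,\dots,s_k$ and $y_0,\dots,y_k$ respectively, and $L_k$ and $D_k$ are the strictly lower triangular part and the diagonal part of $S_k^TY_k$.
   Context: Notation: $S_k=[\,s_0\ s_1\ \cdots\ s_k\,]\in\mathbb{R}^{n\times(k+1)}$ and $Y_k=[\,y_0\ y_1\ \cdots\ y_k\,]\in\mathbb{R}^{n\times(k+1)}$. The matrix $S_k^TY_k\in\mathbb{R}^{(k+1)\times(k+1)}$ is decomposed as $S_k^TY_k=L_k+D_k+R_k$ with $L_k$ strictly lower triangular, $D_k$ diagonal and $R_k$ strictly upper triangular. The matrix $\Psi_k=(B_0S_k\ \ Y_k)$ has columns $B_0s_0,\dots,B_0s_k,y_0,\dots,y_k$ in this order. The case $\phi=0$ of the update is the BFGS update and the case $\phi=1$ is the DFP update. All updates are assumed well-defined; under the assumptions $\gamma>0$ and $s_i^Ty_i>0$ the matrices $B_i$ are symmetric positive definite, so the denominators $s_i^TB_is_i$ are positive. *)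

theory Defs
  imports "HOL-Analysis.Analysis"
begin

definition outer :: "real^'m \<Rightarrow> real^'n \<Rightarrow> real^'n^'m" where
  "outer u v = (\<chi> i j. u $ i * v $ j)"

definition broyden_w :: "real^'n^'n \<Rightarrow> real^'n \<Rightarrow> real^'n \<Rightarrow> real^'n" where
  "broyden_w B s y = (1 / (y \<bullet> s)) *\<^sub>R y - (1 / (s \<bullet> (B *v s))) *\<^sub>R (B *v s)"

definition broyden_update ::
    "real \<Rightarrow> real^'n^'n \<Rightarrow> real^'n \<Rightarrow> real^'n \<Rightarrow> real^'n^'n" where
  "broyden_update \<phi> B s y =
     B - (1 / (s \<bullet> (B *v s))) *\<^sub>R (B ** outer s s ** B)
       + (1 / (y \<bullet> s)) *\<^sub>R outer y y
       + (\<phi> * (s \<bullet> (B *v s))) *\<^sub>R outer (broyden_w B s y) (broyden_w B s y)"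

text \<open>
  An \<open>n \<times> (k + 1)\<close> matrix has its columns indexed by a finite type \<open>'k\<close> together with a
  bijective numbering \<open>pos :: 'k \<Rightarrow> nat\<close> onto \<open>{..k}\<close>; the column at index \<open>j\<close> is the one with
  number \<open>pos j\<close>. A strictly lower triangular entry \<open>(i, j)\<close> is one with \<open>pos j < pos i\<close>.
\<close>

definition col_matrix :: "('k \<Rightarrow> nat) \<Rightarrow> (nat \<Rightarrow> real^'n) \<Rightarrow> real^'k^'n" where
  "col_matrix pos v = (\<chi> a j. v (pos j) $ a)"

definition strict_lower_part :: "('k \<Rightarrow> nat) \<Rightarrow> real^'k^'k \<Rightarrow> real^'k^'k" where
  "strict_lower_part pos A = (\<chi> i j. if pos j < pos i then A $ i $ j else 0)"

definition diag_part :: "real^'k^'k \<Rightarrow> real^'k^'k" where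
  "diag_part A = (\<chi> i j. if i = j then A $ i $ j else 0)"

definition diag_matrix :: "('k \<Rightarrow> nat) \<Rightarrow> (nat \<Rightarrow> real) \<Rightarrow> real^'k^'k" where
  "diag_matrix pos d = (\<chi> i j. if i = j then d (pos i) else 0)"

text \<open>Block matrices are indexed by sum types, the \<open>Inl\<close> indices forming the first block.\<close>

definition hcat :: "real^'a^'n \<Rightarrow> real^'b^'n \<Rightarrow> real^('a + 'b)^'n" where
  "hcat P Q = (\<chi> i j. case j of Inl a \<Rightarrow> P $ i $ a | Inr b \<Rightarrow> Q $ i $ b)"

definition block_matrix ::
    "real^'c^'a \<Rightarrow> real^'d^'a \<Rightarrow> real^'c^'b \<Rightarrow> real^'d^'b \<Rightarrow> real^('c + 'd)^('a + 'b)" where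
  "block_matrix P Q R T = (\<chi> i j. case i of
       Inl a \<Rightarrow> (case j of Inl c \<Rightarrow> P $ a $ c | Inr d \<Rightarrow> Q $ a $ d)
     | Inr b \<Rightarrow> (case j of Inl c \<Rightarrow> R $ b $ c | Inr d \<Rightarrow> T $ b $ d))"

end

theory Submission
  imports Defs
begin

text \<open>
  The inverse \<open>M\<^sub>k\<close> is never computed. Write \<open>N\<close> for the block matrix that is inverted, and consider
  a solution \<open>z = (a, c)\<close> of \<open>N z = \<Psi>\<^sup>T v\<close>, where \<open>a\<close> belongs to the columns \<open>B\<^sub>0 s\<^sub>j\<close> of \<open>\<Psi>\<close> and \<open>c\<close> to
  the columns \<open>y\<^sub>j\<close>. Put
  \<open>tail i = v + \<Sum> {a\<^sub>j s\<^sub>j | i \<le> j \<le> k}\<close> and \<open>head i = B\<^sub>0 (tail 0) + \<Sum> {c\<^sub>j y\<^sub>j | j < i}\<close>. Since the blocks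
  \<open>L\<close> and \<open>L\<^sup>T\<close> of \<open>N\<close> collect exactly the \<open>c\<^sub>j\<close> with \<open>j < i\<close> and the \<open>a\<^sub>j\<close> with \<open>j > i\<close>, the two rows of
  the system numbered \<open>i\<close> say
  \<open>\<phi> \<lambda>\<^sub>i (a\<^sub>i + c\<^sub>i) = s\<^sub>i \<bullet> head i\<close> and
  \<open>\<phi> \<lambda>\<^sub>i (a\<^sub>i + c\<^sub>i) + (s\<^sub>i \<bullet> y\<^sub>i) c\<^sub>i = y\<^sub>i \<bullet> tail (i + 1)\<close>.

  As soon as \<open>head i = B\<^sub>i (tail i)\<close>, this is a system of two equations for \<open>a\<^sub>i\<close> and \<open>c\<^sub>i\<close> alone, with
  right-hand side depending on \<open>tail (i + 1)\<close>. It is nonsingular, and its solution consists of the coefficients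
  for which \<open>B\<^sub>i\<^sub>+\<^sub>1 u = B\<^sub>i (u + a\<^sub>i s\<^sub>i) + c\<^sub>i y\<^sub>i\<close> at \<open>u = tail (i + 1)\<close>: this is the case of a single update,
  \<open>broyden_update_eq_of_system\<close>. Hence \<open>head i = B\<^sub>i (tail i)\<close> propagates from \<open>i\<close> to \<open>i + 1\<close>, and
  for \<open>i = k + 1\<close> it reads \<open>B\<^sub>k\<^sub>+\<^sub>1 v = B\<^sub>0 v + \<Psi> z\<close> (\<open>unrolled_broyden_sequence\<close>).

  The same recursion gives the invertibility of \<open>N\<close>: for \<open>v = 0\<close> one has \<open>tail (k + 1) = 0\<close>, and a nonsingular
  system with zero right-hand side gives \<open>a\<^sub>k = c\<^sub>k = 0\<close>, hence \<open>tail k = 0\<close>, and so on downwards, so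
  \<open>N\<close> has trivial kernel.
\<close>

section \<open>A single update\<close>

definition sym_pos_def :: "real^'n^'n \<Rightarrow> bool" where
  "sym_pos_def A \<longleftrightarrow> transpose A = A \<and> (\<forall>u. u \<noteq> 0 \<longrightarrow> 0 < u \<bullet> (A *v u))"

lemma symmetric_inner_commute:
  fixes A :: "real^'n^'n"
  assumes "transpose A = A"
  shows "u \<bullet> (A *v v) = v \<bullet> (A *v u)"
  using assms by (metis dot_lmul_matrix inner_commute transpose_matrix_vector)

lemma outer_mult_vector: "outer u v *v x = (v \<bullet> x) *\<^sub>R u"
  by (simp add: vec_eq_iff outer_def matrix_vector_mult_def inner_vec_def
      sum_distrib_left sum_distrib_right mult_ac)

text \<open>
  All three correction terms of the update have rank at most one, so applying them to a vector only takes
  inner products; the rest of the argument works with these rather than with matrices.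
\<close>

lemma broyden_update_mult_vector:
  assumes "transpose A = A"
  shows "broyden_update \<phi> A s y *v u =
    A *v u - ((s \<bullet> (A *v u)) / (s \<bullet> (A *v s))) *\<^sub>R (A *v s)
      + ((y \<bullet> u) / (s \<bullet> y)) *\<^sub>R y
      + (\<phi> * (s \<bullet> (A *v s)) * (broyden_w A s y \<bullet> u)) *\<^sub>R broyden_w A s y"
  unfolding broyden_update_def
  by (simp add: matrix_vector_mult_add_rdistrib matrix_vector_mult_diff_rdistrib
      scaleR_matrix_vector_assoc[symmetric] matrix_vector_mul_assoc[symmetric]
      outer_mult_vector matrix_vector_mult_scaleR inner_commute[of y s])

lemma broyden_w_inner:
  assumes "transpose A = A"
  shows "broyden_w A s y \<bullet> u = (y \<bullet> u) / (s \<bullet> y) - (s \<bullet> (A *v u)) / (s \<bullet> (A *v s))"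
  using symmetric_inner_commute[OF assms, of u s]
  by (simp add: broyden_w_def inner_diff_left inner_commute[of y] inner_commute[of "A *v s"])

lemma transpose_outer: "transpose (outer u u) = outer u u"
  by (simp add: vec_eq_iff outer_def transpose_def mult.commute)

lemma transpose_linear:
  "transpose (A + B) = transpose A + transpose (B :: real^'a^'b)"
  "transpose (A - B) = transpose A - transpose (B :: real^'a^'b)"
  "transpose (c *\<^sub>R B) = c *\<^sub>R transpose (B :: real^'a^'b)"
  by (simp_all add: vec_eq_iff transpose_def)

text \<open>
  Write \<open>r\<close> for the component of \<open>u\<close> orthogonal to \<open>s\<close> in the inner product given by \<open>A\<close>. The first correction
  turns \<open>u \<bullet> (A *v u)\<close> into \<open>r \<bullet> (A *v r)\<close>, which can vanish only if \<open>u\<close> is a multiple of \<open>s\<close>, and there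
  the second correction is positive by the curvature condition. The third one is nonnegative.
\<close>

lemma sym_pos_def_broyden_update:
  assumes A: "sym_pos_def A" and sy: "s \<bullet> y > 0" and phi: "\<phi> \<ge> 0"
  shows "sym_pos_def (broyden_update \<phi> A s y)"
  unfolding sym_pos_def_def
proof (intro conjI allI impI)
  have sym: "transpose A = A" and pd: "\<And>u. u \<noteq> 0 \<Longrightarrow> 0 < u \<bullet> (A *v u)"
    using A by (auto simp: sym_pos_def_def)
  show "transpose (broyden_update \<phi> A s y) = broyden_update \<phi> A s y"
    by (simp add: broyden_update_def transpose_linear transpose_outer matrix_transpose_mul sym
        matrix_mul_assoc)
  fix u :: "real^'a" assume "u \<noteq> 0"
  define b where "b = s \<bullet> (A *v s)"
  define r where "r = u - ((s \<bullet> (A *v u)) / b) *\<^sub>R s"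
  have b: "b > 0" using sy pd[of s] by (cases "s = 0") (auto simp: b_def)
  have expand: "u \<bullet> (broyden_update \<phi> A s y *v u)
      = r \<bullet> (A *v r) + (y \<bullet> u)\<^sup>2 / (s \<bullet> y) + \<phi> * b * (broyden_w A s y \<bullet> u)\<^sup>2"
    using b symmetric_inner_commute[OF sym, of u s]
    by (simp add: broyden_update_mult_vector[OF sym] r_def b_def[symmetric]
        inner_add_right inner_diff_right inner_diff_left matrix_vector_mult_diff_distrib
        matrix_vector_mult_scaleR inner_commute[of u y] inner_commute[of u "broyden_w A s y"])
      (simp add: field_simps power2_eq_square)
  have w: "0 \<le> \<phi> * b * (broyden_w A s y \<bullet> u)\<^sup>2" using phi b by simp
  show "0 < u \<bullet> (broyden_update \<phi> A s y *v u)"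
  proof (cases "r = 0")
    case False
    then show ?thesis using pd[of r] w sy by (simp add: expand add_pos_nonneg)
  next
    case True
    define t where "t = (s \<bullet> (A *v u)) / b"
    have "u = t *\<^sub>R s" using True by (simp add: r_def t_def)
    with \<open>u \<noteq> 0\<close> sy have "y \<bullet> u \<noteq> 0" by (auto simp: inner_commute)
    then show ?thesis using w sy by (simp add: expand True add_pos_nonneg)
  qed
qed

text \<open>
  The value of \<open>l\<close> is \<open>- b d / e\<close> with \<open>e = (1 - \<phi>) d + \<phi> b > 0\<close>, and the determinant of the
  system is \<open>- b d\<^sup>2 / e\<close>. Solving for \<open>m = \<phi> l (p + q)\<close> first avoids dividing by \<open>\<phi>\<close>, so that
  \<open>\<phi> = 0\<close> needs no separate treatment.
\<close>

lemma two_by_two_solution: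
  fixes b d \<phi> p q \<alpha> \<beta> :: real
  assumes b: "b > 0" and d: "d > 0" and phi: "0 \<le> \<phi>" "\<phi> \<le> 1"
    and l: "l = 1 / (- ((1 - \<phi>) / b) - \<phi> / d)"
    and eq1: "\<phi> * l * (p + q) = \<alpha> + p * b"
    and eq2: "\<phi> * l * (p + q) + d * q = \<beta>"
  shows "p = - \<alpha> / b - \<phi> * (\<beta> / d - \<alpha> / b)"
    and "q = \<beta> / d + \<phi> * b * (\<beta> / d - \<alpha> / b) / d"
proof -
  define e where "e = (1 - \<phi>) * d + \<phi> * b"
  have e: "e > 0"
  proof (cases "\<phi> = 0")
    case False
    then show ?thesis using b d phi by (simp add: e_def add_nonneg_pos)
  qed (use d in \<open>simp add: e_def\<close>)
  have le: "l * e = - (b * d)"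
  proof -
    have "- ((1 - \<phi>) / b) - \<phi> / d = - (e / (b * d))"
      using b d by (simp add: e_def field_simps)
    then show ?thesis using e by (simp add: l)
  qed
  define \<alpha>' \<beta>' where "\<alpha>' = \<alpha> / b" and "\<beta>' = \<beta> / d"
  have ab: "\<alpha> = \<alpha>' * b" "\<beta> = \<beta>' * d" using b d by (auto simp: \<alpha>'_def \<beta>'_def)
  define m where "m = \<phi> * l * (p + q)"
  have p: "p = m / b - \<alpha>'" and q: "q = \<beta>' - m / d"
    using eq1 eq2 b d unfolding ab m_def[symmetric] by (simp_all add: field_simps)
  have "m * e = - \<phi> * (b * d) * (p + q)"
    using le by (simp add: m_def) (metis (no_types, lifting) mult.assoc mult.commute mult_minus_right)
  also have "\<dots> = - \<phi> * (m * d - m * b + b * d * (\<beta>' - \<alpha>'))"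
    using b d unfolding p q by (simp add: field_simps)
  finally have "m * d = - \<phi> * (b * d * (\<beta>' - \<alpha>'))"
    unfolding e_def by (simp add: algebra_simps)
  then have "d * m = d * (- \<phi> * b * (\<beta>' - \<alpha>'))" by (simp add: algebra_simps)
  then have m: "m = - \<phi> * b * (\<beta>' - \<alpha>')" using d by (simp only: mult_cancel_left) simp
  show "p = - \<alpha> / b - \<phi> * (\<beta> / d - \<alpha> / b)"
    using b unfolding p m by (simp add: \<alpha>'_def \<beta>'_def field_simps)
  show "q = \<beta> / d + \<phi> * b * (\<beta> / d - \<alpha> / b) / d"
    unfolding q m by (simp add: \<alpha>'_def \<beta>'_def)
qed

text \<open>
  This is the factorization for one update: the vector \<open>(p, q)\<close> is the inverse of the
  \<open>2 \<times> 2\<close> matrix \<open>N\<close> applied to \<open>(s \<bullet> (A *v u), y \<bullet> u)\<close>. The term \<open>p * (s \<bullet> (A *v s))\<close> has been moved to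
  the right-hand side, because in a sequence of updates the argument \<open>u + p *\<^sub>R s\<close> is what the preceding
  matrix is applied to. The second claim is the nonsingularity.
\<close>

lemma broyden_update_eq_of_system:
  assumes A: "sym_pos_def A" and sy: "s \<bullet> y > 0" and phi: "0 \<le> \<phi>" "\<phi> \<le> 1"
    and l: "l = 1 / (- ((1 - \<phi>) / (s \<bullet> (A *v s))) - \<phi> / (s \<bullet> y))"
    and eq1: "\<phi> * l * (p + q) = s \<bullet> (A *v (u + p *\<^sub>R s))"
    and eq2: "\<phi> * l * (p + q) + (s \<bullet> y) * q = y \<bullet> u"
  shows "broyden_update \<phi> A s y *v u = A *v (u + p *\<^sub>R s) + q *\<^sub>R y"
    and "u = 0 \<Longrightarrow> p = 0 \<and> q = 0"
proof -
  have sym: "transpose A = A" and b: "s \<bullet> (A *v s) > 0"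
    using A sy by (cases "s = 0"; simp add: sym_pos_def_def)+
  have eq1': "\<phi> * l * (p + q) = s \<bullet> (A *v u) + p * (s \<bullet> (A *v s))"
    using eq1 by (simp add: matrix_vector_right_distrib matrix_vector_mult_scaleR inner_add_right)
  note pq = two_by_two_solution[OF b sy phi l eq1' eq2]
  show "u = 0 \<Longrightarrow> p = 0 \<and> q = 0" using pq by simp
  define W where "W = (y \<bullet> u) / (s \<bullet> y) - (s \<bullet> (A *v u)) / (s \<bullet> (A *v s))"
  have "broyden_update \<phi> A s y *v u =
    A *v u - ((s \<bullet> (A *v u)) / (s \<bullet> (A *v s))) *\<^sub>R (A *v s)
      + ((y \<bullet> u) / (s \<bullet> y)) *\<^sub>R y
      + (\<phi> * (s \<bullet> (A *v s)) * W) *\<^sub>R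
          ((1 / (s \<bullet> y)) *\<^sub>R y - (1 / (s \<bullet> (A *v s))) *\<^sub>R (A *v s))"
    unfolding broyden_update_mult_vector[OF sym] broyden_w_inner[OF sym] W_def
    by (simp add: broyden_w_def inner_commute)
  also have "\<dots> = A *v u + p *\<^sub>R (A *v s) + q *\<^sub>R y"
    using b unfolding pq W_def[symmetric]
    by (simp add: algebra_simps)
  finally show "broyden_update \<phi> A s y *v u = A *v (u + p *\<^sub>R s) + q *\<^sub>R y"
    by (simp add: matrix_vector_right_distrib matrix_vector_mult_scaleR)
qed

section \<open>The sequence of updates\<close>

lemma sym_pos_def_scaled_identity:
  assumes "\<gamma> > 0"
  shows "sym_pos_def (\<gamma> *\<^sub>R mat 1 :: real^'n^'n)"
  using assms by (simp add: sym_pos_def_def transpose_linear transpose_mat scaleR_matrix_vector_assoc[symmetric])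

lemma sym_pos_def_broyden_sequence:
  assumes "sym_pos_def (B 0)" and "\<phi> \<ge> 0"
    and "\<And>i. i \<le> k \<Longrightarrow> s i \<bullet> y i > 0"
    and "\<And>i. i \<le> k \<Longrightarrow> B (Suc i) = broyden_update \<phi> (B i) (s i) (y i)"
    and "i \<le> Suc k"
  shows "sym_pos_def (B i)"
  using \<open>i \<le> Suc k\<close>
proof (induction i)
  case (Suc i)
  then show ?case using assms(2-4) by (simp add: sym_pos_def_broyden_update)
qed (use assms(1) in simp)

text \<open>
  The induction for \<open>head i = B i *v tail i\<close> runs upwards, because row \<open>i\<close> becomes a statement about \<open>B i\<close> only
  once \<open>head i\<close> is known; the induction for \<open>tail i = 0\<close> runs downwards from \<open>tail (Suc k) = v\<close>
  and rests on the first one.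
\<close>

lemma unrolled_broyden_sequence:
  fixes B :: "nat \<Rightarrow> real^'n^'n" and a c lam :: "nat \<Rightarrow> real"
    and s y :: "nat \<Rightarrow> real^'n" and v :: "real^'n" and k :: nat
  defines "tail \<equiv> \<lambda>i. v + (\<Sum>j\<in>{i..<Suc k}. a j *\<^sub>R s j)"
  defines "head \<equiv> \<lambda>i. B 0 *v tail 0 + (\<Sum>j<i. c j *\<^sub>R y j)"
  assumes sym_pos_def_0: "sym_pos_def (B 0)" and phi: "0 \<le> \<phi>" "\<phi> \<le> 1"
    and curvature: "\<And>i. i \<le> k \<Longrightarrow> s i \<bullet> y i > 0"
    and B_Suc: "\<And>i. i \<le> k \<Longrightarrow> B (Suc i) = broyden_update \<phi> (B i) (s i) (y i)"
    and lam: "\<And>i. i \<le> k \<Longrightarrow>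
      lam i = 1 / (- ((1 - \<phi>) / (s i \<bullet> (B i *v s i))) - \<phi> / (s i \<bullet> y i))"
    and row1: "\<And>i. i \<le> k \<Longrightarrow> \<phi> * lam i * (a i + c i) = s i \<bullet> head i"
    and row2: "\<And>i. i \<le> k \<Longrightarrow>
      \<phi> * lam i * (a i + c i) + (s i \<bullet> y i) * c i = y i \<bullet> tail (Suc i)"
  shows "B (Suc k) *v v = head (Suc k)"
    and "v = 0 \<Longrightarrow> i \<le> k \<Longrightarrow> a i = 0 \<and> c i = 0"
proof -
  have sym_pos_def: "sym_pos_def (B i)" if "i \<le> Suc k" for i
    using sym_pos_def_broyden_sequence[of B \<phi> k s y, OF sym_pos_def_0 phi(1) curvature B_Suc that] .
  have tail_step: "tail i = tail (Suc i) + a i *\<^sub>R s i" if "i \<le> k" for i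
    using that sum.atLeast_Suc_lessThan[of i "Suc k" "\<lambda>j. a j *\<^sub>R s j"]
    by (simp add: tail_def del: sum.op_ivl_Suc)
  have head_eq: "head i = B i *v tail i" if "i \<le> Suc k" for i
    using that
  proof (induction i)
    case 0
    then show ?case by (simp add: head_def)
  next
    case (Suc i)
    then have i: "i \<le> k" and IH: "head i = B i *v (tail (Suc i) + a i *\<^sub>R s i)"
      by (simp_all add: tail_step)
    have "B (Suc i) *v tail (Suc i) = head i + c i *\<^sub>R y i"
      unfolding B_Suc[OF i] IH
      by (rule broyden_update_eq_of_system(1)[OF _ curvature[OF i] phi lam[OF i]])
        (use sym_pos_def[of i] i row1[OF i] row2[OF i] IH in auto)
    then show ?case by (simp add: head_def)
  qed
  show "B (Suc k) *v v = head (Suc k)"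
    using head_eq[of "Suc k"] by (simp add: tail_def)
  assume v: "v = 0" and "i \<le> k"
  have pair: "a i = 0 \<and> c i = 0" if "i \<le> k" "tail (Suc i) = 0" for i
  proof (rule broyden_update_eq_of_system(2)[OF _ curvature[OF that(1)] phi lam[OF that(1)]])
    show "\<phi> * lam i * (a i + c i) = s i \<bullet> (B i *v (tail (Suc i) + a i *\<^sub>R s i))"
      using row1[of i] head_eq[of i] tail_step[of i] that(1) by simp
  qed (use that sym_pos_def[of i] row2[of i] in auto)
  have "tail i = 0" if "i \<le> Suc k" for i
    using that
  proof (induction i rule: inc_induct)
    case base
    then show ?case by (simp add: tail_def v)
  next
    case (step i)
    then show ?case using pair[of i] tail_step[of i] by simp
  qed
  then show "a i = 0 \<and> c i = 0" using pair \<open>i \<le> k\<close> by simp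
qed

section \<open>Block matrices and triangular parts acting on vectors\<close>

lemma sum_UNIV_Plus:
  fixes g :: "'a::finite + 'b::finite \<Rightarrow> 'c::comm_monoid_add"
  shows "sum g UNIV = (\<Sum>i\<in>UNIV. g (Inl i)) + (\<Sum>i\<in>UNIV. g (Inr i))"
  by (subst UNIV_Plus_UNIV[symmetric]) (simp add: sum.Plus del: UNIV_Plus_UNIV)

lemma block_matrix_mult_vector:
  "(block_matrix P Q R T *v z) $ Inl i = (P *v (\<chi> j. z $ Inl j)) $ i + (Q *v (\<chi> j. z $ Inr j)) $ i"
  "(block_matrix P Q R T *v z) $ Inr i' = (R *v (\<chi> j. z $ Inl j)) $ i' + (T *v (\<chi> j. z $ Inr j)) $ i'"
  by (simp_all add: block_matrix_def matrix_vector_mult_def sum_UNIV_Plus)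

lemma hcat_mult_vector: "hcat P Q *v z = P *v (\<chi> j. z $ Inl j) + Q *v (\<chi> j. z $ Inr j)"
  by (simp add: vec_eq_iff hcat_def matrix_vector_mult_def sum_UNIV_Plus)

lemma transpose_hcat_mult_vector:
  "(transpose (hcat P Q) *v v) $ Inl i = (transpose P *v v) $ i"
  "(transpose (hcat P Q) *v v) $ Inr i' = (transpose Q *v v) $ i'"
  by (simp_all add: hcat_def matrix_vector_mult_def transpose_def)

lemma transpose_col_matrix_mult_vector: "(transpose (col_matrix pos u) *v v) $ i = u (pos i) \<bullet> v"
  by (simp add: matrix_vector_mult_def transpose_def col_matrix_def inner_vec_def)

lemma transpose_entry: "transpose A $ i $ j = A $ j $ i"
  by (simp add: transpose_def)

lemma gram_entry: "(transpose (col_matrix pos s) ** col_matrix pos y) $ i $ j = s (pos i) \<bullet> y (pos j)"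
  by (simp add: matrix_matrix_mult_def transpose_def col_matrix_def inner_vec_def)

lemma diag_matrix_mult_vector: "(diag_matrix pos d *v v) $ i = d (pos i) * v $ i"
  by (simp add: diag_matrix_def matrix_vector_mult_def if_distrib[of "\<lambda>x. x * _"] cong: if_cong)

lemma diag_part_mult_vector: "(diag_part A *v v) $ i = A $ i $ i * v $ i"
  by (simp add: diag_part_def matrix_vector_mult_def if_distrib[of "\<lambda>x. x * _"] cong: if_cong)

lemma matrix_vector_minus: "(- A) *v v = - (A *v (v :: real^'a) :: real^'b)"
  by (simp add: vec_eq_iff matrix_vector_mult_def sum_negf)

lemma matrix_inv_right: "invertible A \<Longrightarrow> A ** matrix_inv A = mat 1"
  unfolding invertible_def matrix_inv_def by (rule conjunct1, erule someI_ex)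

text \<open>
  The column indices form an unordered type. The bijection \<open>pos\<close> turns sums over it into sums over \<open>{0..<Suc k}\<close>,
  and multiplication by the strict triangular parts then becomes summation over initial and final segments.
\<close>

context
  fixes pos :: "'k::finite \<Rightarrow> nat" and k :: nat
  assumes pos: "bij_betw pos UNIV {0..k}"
begin

lemma sum_pos: "(\<Sum>j\<in>UNIV. g (pos j)) = sum g {0..<Suc k}"
  using sum.reindex_bij_betw[OF pos, of g] by (simp add: atLeastLessThanSuc_atLeastAtMost)

lemma pos_le: "pos i \<le> k"
  using bij_betwE[OF pos] by auto

lemma col_matrix_mult_vector:
  "col_matrix pos u *v (\<chi> j. a (pos j)) = (\<Sum>j\<in>{0..<Suc k}. a j *\<^sub>R u j)"
proof -
  have "col_matrix pos u *v (\<chi> j. a (pos j)) = (\<Sum>j\<in>UNIV. a (pos j) *\<^sub>R u (pos j))"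
    by (simp add: vec_eq_iff matrix_vector_mult_def col_matrix_def mult.commute)
  then show ?thesis by (simp add: sum_pos[of "\<lambda>j. a j *\<^sub>R u j"])
qed

lemma strict_lower_part_mult_vector:
  "(strict_lower_part pos (transpose (col_matrix pos s) ** col_matrix pos y) *v (\<chi> j. c (pos j))) $ i
     = s (pos i) \<bullet> (\<Sum>j<pos i. c j *\<^sub>R y j)"
proof -
  let ?g = "\<lambda>j. if j < pos i then c j * (s (pos i) \<bullet> y j) else 0"
  have "(strict_lower_part pos (transpose (col_matrix pos s) ** col_matrix pos y) *v (\<chi> j. c (pos j))) $ i
     = (\<Sum>j\<in>UNIV. ?g (pos j))"
    by (simp add: strict_lower_part_def matrix_vector_mult_def gram_entry mult.commute
        cong: if_cong) (intro sum.cong; simp)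
  also have "\<dots> = (\<Sum>j\<in>{j\<in>{0..<Suc k}. j < pos i}. c j * (s (pos i) \<bullet> y j))"
    by (simp only: sum_pos[of ?g] sum.inter_filter[OF finite_atLeastLessThan])
  also have "{j\<in>{0..<Suc k}. j < pos i} = {..<pos i}"
    using pos_le[of i] by auto
  finally show ?thesis by (simp add: inner_sum_right)
qed

lemma transpose_strict_lower_part_mult_vector:
  "(transpose (strict_lower_part pos (transpose (col_matrix pos s) ** col_matrix pos y))
      *v (\<chi> j. a (pos j))) $ i
     = y (pos i) \<bullet> (\<Sum>j\<in>{Suc (pos i)..<Suc k}. a j *\<^sub>R s j)"
proof -
  let ?g = "\<lambda>j. if pos i < j then a j * (s j \<bullet> y (pos i)) else 0"
  have "(transpose (strict_lower_part pos (transpose (col_matrix pos s) ** col_matrix pos y))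
      *v (\<chi> j. a (pos j))) $ i = (\<Sum>j\<in>UNIV. ?g (pos j))"
    by (simp add: strict_lower_part_def matrix_vector_mult_def transpose_entry gram_entry mult.commute
        cong: if_cong del: transpose_matrix_vector) (intro sum.cong; simp)
  also have "\<dots> = (\<Sum>j\<in>{j\<in>{0..<Suc k}. pos i < j}. a j * (s j \<bullet> y (pos i)))"
    by (simp only: sum_pos[of ?g] sum.inter_filter[OF finite_atLeastLessThan])
  also have "{j\<in>{0..<Suc k}. pos i < j} = {Suc (pos i)..<Suc k}"
    by auto
  finally show ?thesis by (simp only: inner_sum_right inner_scaleR_right inner_commute[of "y _"])
qed

end

theorem theorem1:
  fixes f :: "real^'n \<Rightarrow> real" and grad_f :: "real^'n \<Rightarrow> real^'n"
    and k :: nat and pos :: "'k::finite \<Rightarrow> nat"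
    and x s y :: "nat \<Rightarrow> real^'n"
    and \<phi> \<gamma> :: real and B :: "nat \<Rightarrow> real^'n^'n" and lam :: "nat \<Rightarrow> real"
  assumes pos: "bij_betw pos UNIV {0..k}"
    and f_grad: "\<And>z. GDERIV f z :> grad_f z"
    and f_C1: "continuous_on UNIV grad_f"
    and s: "\<And>i. i \<le> k \<Longrightarrow> s i = x (Suc i) - x i"
    and y: "\<And>i. i \<le> k \<Longrightarrow> y i = grad_f (x (Suc i)) - grad_f (x i)"
    and curvature: "\<And>i. i \<le> k \<Longrightarrow> s i \<bullet> y i > 0"
    and phi: "\<phi> \<in> {0..1}"
    and gamma: "\<gamma> > 0"
    and B_0: "B 0 = \<gamma> *\<^sub>R mat 1"
    and B_Suc: "\<And>i. i \<le> k \<Longrightarrow> B (Suc i) = broyden_update \<phi> (B i) (s i) (y i)"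
    and lam: "\<And>i. i \<le> k \<Longrightarrow>
      lam i = 1 / (- ((1 - \<phi>) / (s i \<bullet> (B i *v s i))) - \<phi> / (s i \<bullet> y i))"
  shows "let S = col_matrix pos s; Y = col_matrix pos y;
             L = strict_lower_part pos (transpose S ** Y);
             D = diag_part (transpose S ** Y);
             \<Lambda> = diag_matrix pos lam;
             \<Psi> = hcat (B 0 ** S) Y;
             N = block_matrix
                   (- (transpose S ** B 0 ** S) + \<phi> *\<^sub>R \<Lambda>)  (- L + \<phi> *\<^sub>R \<Lambda>)
                   (- transpose L + \<phi> *\<^sub>R \<Lambda>)              (D + \<phi> *\<^sub>R \<Lambda>)
         in invertible N \<and> B (Suc k) = B 0 + \<Psi> ** matrix_inv N ** transpose \<Psi>"
proof -
  define S where "S = col_matrix pos s"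
  define Y where "Y = col_matrix pos y"
  define L where "L = strict_lower_part pos (transpose S ** Y)"
  define D where "D = diag_part (transpose S ** Y)"
  define \<Lambda> where "\<Lambda> = diag_matrix pos lam"
  define \<Psi> where "\<Psi> = hcat (B 0 ** S) Y"
  define N where "N = block_matrix
    (- (transpose S ** B 0 ** S) + \<phi> *\<^sub>R \<Lambda>) (- L + \<phi> *\<^sub>R \<Lambda>)
    (- transpose L + \<phi> *\<^sub>R \<Lambda>) (D + \<phi> *\<^sub>R \<Lambda>)"
  have sym_pos_def_0: "sym_pos_def (B 0)" using B_0 gamma sym_pos_def_scaled_identity by simp
  have phi': "0 \<le> \<phi>" "\<phi> \<le> 1" using phi by auto
  have sym_0: "transpose (B 0) = B 0" using sym_pos_def_0 by (simp add: sym_pos_def_def)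
  \<comment> \<open>Coefficients are indexed by numbers from here on, as the sequence of updates requires.\<close>
  let ?num = "inv_into UNIV pos"
  have num: "?num (pos i) = i" for i
    using pos by (simp add: bij_betw_def)
  have pos_num: "pos (?num n) = n" if "n \<le> k" for n
    using bij_betw_inv_into_right[OF pos, of n] that by simp
  \<comment> \<open>With \<open>v = 0\<close> this says that \<open>N\<close> has trivial kernel; with \<open>z\<close> the image of
    \<open>transpose \<Psi> *v v\<close> under the inverse of \<open>N\<close>, that the two sides of the claimed identity agree on \<open>v\<close>.\<close>
  have key: "B (Suc k) *v v = B 0 *v v + \<Psi> *v z \<and> (v = 0 \<longrightarrow> z = 0)"
    if Nz: "N *v z = transpose \<Psi> *v v" for z v
  proof -
    define a where "a n = z $ Inl (?num n)" for n
    define c where "c n = z $ Inr (?num n)" for n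
    have za: "(\<chi> j. z $ Inl j) = (\<chi> j. a (pos j))" and zc: "(\<chi> j. z $ Inr j) = (\<chi> j. c (pos j))"
      by (simp_all add: a_def c_def num)
    define tail where "tail i = v + (\<Sum>j\<in>{i..<Suc k}. a j *\<^sub>R s j)" for i
    define head where "head i = B 0 *v tail 0 + (\<Sum>j<i. c j *\<^sub>R y j)" for i
    have Sa: "S *v (\<chi> j. a (pos j)) = tail 0 - v"
      by (simp add: S_def tail_def col_matrix_mult_vector[OF pos])
    have row1: "\<phi> * lam n * (a n + c n) = s n \<bullet> head n" if "n \<le> k" for n
    proof -
      have "(N *v z) $ Inl (?num n) = (transpose \<Psi> *v v) $ Inl (?num n)" by (simp add: Nz)
      then show ?thesis
        unfolding N_def \<Psi>_def block_matrix_mult_vector transpose_hcat_mult_vector za zc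
        by (simp add: matrix_vector_mult_add_rdistrib matrix_vector_minus matrix_transpose_mul sym_0
            matrix_vector_mul_assoc[symmetric] scaleR_matrix_vector_assoc[symmetric] Sa
            del: transpose_matrix_vector)
          (simp add: matrix_vector_mul_assoc[symmetric] scaleR_matrix_vector_assoc[symmetric] Sa[unfolded S_def] S_def Y_def L_def \<Lambda>_def transpose_col_matrix_mult_vector
            strict_lower_part_mult_vector[OF pos] diag_matrix_mult_vector pos_num that head_def
            matrix_vector_mult_diff_distrib inner_diff_right inner_add_right algebra_simps
            del: transpose_matrix_vector)
    qed
    have row2: "\<phi> * lam n * (a n + c n) + (s n \<bullet> y n) * c n = y n \<bullet> tail (Suc n)" if "n \<le> k" for n
    proof -
      have "(N *v z) $ Inr (?num n) = (transpose \<Psi> *v v) $ Inr (?num n)" by (simp add: Nz)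
      then show ?thesis
        unfolding N_def \<Psi>_def block_matrix_mult_vector transpose_hcat_mult_vector za zc
        by (simp add: matrix_vector_mult_add_rdistrib matrix_vector_minus
            scaleR_matrix_vector_assoc[symmetric] del: transpose_matrix_vector)
          (simp add: scaleR_matrix_vector_assoc[symmetric] S_def Y_def L_def D_def \<Lambda>_def transpose_col_matrix_mult_vector
            transpose_strict_lower_part_mult_vector[OF pos] diag_matrix_mult_vector
            diag_part_mult_vector gram_entry pos_num that tail_def inner_add_right algebra_simps
            del: transpose_matrix_vector)
    qed
    note unrolled = unrolled_broyden_sequence[of B \<phi> k s y lam a c v, folded tail_def, folded head_def,
        OF sym_pos_def_0 phi' curvature B_Suc lam row1 row2]
    have "\<Psi> *v z = B 0 *v (tail 0 - v) + (\<Sum>j<Suc k. c j *\<^sub>R y j)"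
      by (simp add: \<Psi>_def hcat_mult_vector za zc matrix_vector_mul_assoc[symmetric] Sa
          Y_def col_matrix_mult_vector[OF pos] lessThan_atLeast0)
    then have "B (Suc k) *v v = B 0 *v v + \<Psi> *v z"
      using unrolled(1) by (simp add: head_def matrix_vector_mult_diff_distrib)
    moreover have "z = 0" if "v = 0"
    proof -
      have "z $ i = 0" for i
        using unrolled(2)[OF _ _ _ _ _ that] pos_le[OF pos]
        by (cases i) (metis a_def c_def num)+
      then show ?thesis by (simp add: vec_eq_iff)
    qed
    ultimately show ?thesis by blast
  qed
  have inv: "invertible N"
    unfolding invertible_left_inverse matrix_left_invertible_ker using key[of _ 0] by simp
  have "B (Suc k) = B 0 + \<Psi> ** matrix_inv N ** transpose \<Psi>"
    unfolding matrix_eq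
  proof
    fix v
    have "N *v (matrix_inv N *v (transpose \<Psi> *v v)) = transpose \<Psi> *v v"
      by (simp add: matrix_vector_mul_assoc matrix_inv_right[OF inv])
    from key[OF this] show "B (Suc k) *v v = (B 0 + \<Psi> ** matrix_inv N ** transpose \<Psi>) *v v"
      by (simp add: matrix_vector_mult_add_rdistrib matrix_vector_mul_assoc matrix_mul_assoc
          del: transpose_matrix_vector)
  qed
  with inv show ?thesis
    by (simp add: Let_def S_def Y_def L_def D_def \<Lambda>_def \<Psi>_def N_def)
qed

end
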